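(* Fix $p\in[1,\infty)$, a metric space $(X,d_X)$ and $n_1,d_1,d_2\in\mathbb N$. Suppose that $G_1=(V_1,E_1)$ is an $n_1$-vertex graph which is $d_1$-regular and that $G_2=(V_2,E_2)$ is a $d_1$-vertex graph which is $d_2$-regular. Then (for every choice of labeling in the definition of the replacement product $G_1 ⓡ G_2$) $$\gamma_+\left(G_1 ⓡ G_2,d_X^p\right)\le3^{p-1}(d_2+1)\cdot\gamma_+\left(G_1,d_X^p\right)\cdot\gamma_+\left(G_2,d_X^p\right)^2.$$
   Context: Graphs are finite and undirected, with self loops and multiple edges allowed: a graph $G=(V,E)$ consists of a finite set $V$ and nonnegative integers $E(u,v)=E(v,u)$. The degree of $u$ is $\sum_vE(u,v)$ (each self loop contributes $1$); $G$ is $d$-regular if all degrees equal $d$; its normalized adjacency matrix is $A_G=(E(u,v)/d)_{u,v}$. For a symmetric $K:X\times X\to[0,\infty)$ and an $n\times n$ symmetric stochastic matrix $A=(a_{ij})$, $\gamma_+(A,K)\in[0,\infty]$ is the infimum over those $\gamma_+>0$ such that for all $x_1,\ldots,x_n,y_1,\ldots,y_n\in X$, $$\frac1{n^2}\sum_{i,j=1}^nK(x_i,y_j)\le\frac{\gamma_+}{n}\sum_{i,j=1}^na_{ij}K(x_i,y_j)$$ ($\infty$ if there is no finite such $\gamma_+$). For a regular graph $G$, $\gamma_+(G,K)=\gamma_+(A_G,K)$. Replacement product. Regard $E_1$ as a multiset of ordered pairs containing $E_1(u,v)$ copies of $(u,v)$, and fix a pairing $e\mapsto\bar e$ (an involution)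 of the copies of $(u,v)$ with the copies of $(v,u)$. For every $u\in V_1$ fix a bijection $\pi_u$ from the $d_1$ edge copies of the form $(u,\cdot)$ onto $V_2$ (the labeling). The replacement product $G_1 ⓡ G_2$ is the $(d_2+1)$-regular graph with vertex set $V_1\times V_2$ in which the number of edges joining $(u,i)$ and $(v,j)$ is $$E_2(i,j)\mathbf 1_{\{u=v\}}+\sum_{e\text{ a copy of }(u,v)\text{ in }E_1}\mathbf 1_{\{i=\pi_u(e)\}}\mathbf 1_{\{j=\pi_v(\bar e)\}} .$$ *)

theory Defs
  imports "HOL-Analysis.Analysis"
begin

text \<open>
  The function \<open>num_edges\<close> gives the number of edges joining two vertices; only its values on
  \<open>verts G \<times> verts G\<close> are ever used.
\<close>
record 'v multigraph =
  verts :: "'v set"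
  num_edges :: "'v \<Rightarrow> 'v \<Rightarrow> nat"

definition is_multigraph :: "'v multigraph \<Rightarrow> bool" where
  "is_multigraph G \<longleftrightarrow>
     finite (verts G) \<and> (\<forall>u\<in>verts G. \<forall>v\<in>verts G. num_edges G u v = num_edges G v u)"

definition vertex_degree :: "'v multigraph \<Rightarrow> 'v \<Rightarrow> nat" where
  "vertex_degree G u = (\<Sum>v\<in>verts G. num_edges G u v)"

definition regular :: "nat \<Rightarrow> 'v multigraph \<Rightarrow> bool" where
  "regular d G \<longleftrightarrow> is_multigraph G \<and> (\<forall>u\<in>verts G. vertex_degree G u = d)"

text \<open>
  Only meant for regular \<open>G\<close>, where \<open>vertex_degree G u\<close> is the common degree \<open>d\<close>, so that the entries
  are \<open>E(u,v) / d\<close>.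
\<close>
definition normalized_adjacency :: "'v multigraph \<Rightarrow> 'v \<Rightarrow> 'v \<Rightarrow> real" where
  "normalized_adjacency G u v = real (num_edges G u v) / real (vertex_degree G u)"

text \<open>
  The Poincare constant of a kernel \<open>K\<close> on \<open>X\<close> with respect to a matrix \<open>A\<close> whose rows and
  columns are indexed by a finite set \<open>I\<close> (with \<open>n = card I\<close>).  The infimum is taken
  in \<open>[0,\<infinity>]\<close>, so it is \<open>\<infinity>\<close> if no finite constant is admissible.
\<close>
definition gamma_plus ::
  "'i set \<Rightarrow> ('i \<Rightarrow> 'i \<Rightarrow> real) \<Rightarrow> 'a set \<Rightarrow> ('a \<Rightarrow> 'a \<Rightarrow> real) \<Rightarrow> ennreal" where
  "gamma_plus I A X K =
     Inf (ennreal ` {g::real. 0 < g \<and>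
       (\<forall>x \<in> I \<rightarrow> X. \<forall>y \<in> I \<rightarrow> X.
          1 / (real (card I))\<^sup>2 * (\<Sum>i\<in>I. \<Sum>j\<in>I. K (x i) (y j))
          \<le> g / real (card I) * (\<Sum>i\<in>I. \<Sum>j\<in>I. A i j * K (x i) (y j)))})"

definition gamma_plus_graph ::
  "'v multigraph \<Rightarrow> 'a set \<Rightarrow> ('a \<Rightarrow> 'a \<Rightarrow> real) \<Rightarrow> ennreal" where
  "gamma_plus_graph G X K = gamma_plus (verts G) (normalized_adjacency G) X K"

text \<open>The \<open>num_edges G u v\<close> copies of the ordered pair \<open>(u,v)\<close> are the triples \<open>(u,v,k)\<close>.\<close>
type_synonym 'v edge_copy = "'v \<times> 'v \<times> nat"

definition copies :: "'v multigraph \<Rightarrow> 'v \<Rightarrow> 'v \<Rightarrow> 'v edge_copy set" where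
  "copies G u v = {(u, v, k) | k. k < num_edges G u v}"

definition copies_from :: "'v multigraph \<Rightarrow> 'v \<Rightarrow> 'v edge_copy set" where
  "copies_from G u = (\<Union>v\<in>verts G. copies G u v)"

text \<open>A copy of a self loop may be paired with itself.\<close>
definition edge_pairing :: "'v multigraph \<Rightarrow> ('v edge_copy \<Rightarrow> 'v edge_copy) \<Rightarrow> bool" where
  "edge_pairing G bar \<longleftrightarrow>
     (\<forall>u\<in>verts G. \<forall>v\<in>verts G. \<forall>e\<in>copies G u v. bar e \<in> copies G v u \<and> bar (bar e) = e)"

definition edge_labeling ::
  "'v multigraph \<Rightarrow> 'w multigraph \<Rightarrow> ('v \<Rightarrow> 'v edge_copy \<Rightarrow> 'w) \<Rightarrow> bool" where
  "edge_labeling G1 G2 \<pi> \<longleftrightarrow>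
     (\<forall>u\<in>verts G1. bij_betw (\<pi> u) (copies_from G1 u) (verts G2))"

definition replacement_product ::
  "'v multigraph \<Rightarrow> 'w multigraph \<Rightarrow> ('v edge_copy \<Rightarrow> 'v edge_copy) \<Rightarrow>
   ('v \<Rightarrow> 'v edge_copy \<Rightarrow> 'w) \<Rightarrow> ('v \<times> 'w) multigraph" where
  "replacement_product G1 G2 bar \<pi> =
     \<lparr> verts = verts G1 \<times> verts G2,
       num_edges = (\<lambda>(u, i) (v, j).
         num_edges G2 i j * of_bool (u = v) +
         (\<Sum>e\<in>copies G1 u v. of_bool (i = \<pi> u e) * of_bool (j = \<pi> v (bar e)))) \<rparr>"

lemma finite_copies: "finite (copies G u v)"
proof -
  have "copies G u v = (\<lambda>k. (u, v, k)) ` {..<num_edges G u v}"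
    by (auto simp: copies_def)
  then show ?thesis by simp
qed

lemma replacement_product_regular:
  assumes G1: "regular d1 G1" and G2: "regular d2 G2"
    and bar: "edge_pairing G1 bar" and lab: "edge_labeling G1 G2 \<pi>"
  shows "regular (d2 + 1) (replacement_product G1 G2 bar \<pi>)"
proof -
  let ?V1 = "verts G1" and ?V2 = "verts G2"
  let ?c = "\<lambda>u v i j. \<Sum>e\<in>copies G1 u v. of_bool (i = \<pi> u e) * (of_bool (j = \<pi> v (bar e)) :: nat)"
  have fin: "finite ?V1" "finite ?V2"
    and sym2: "\<And>i j. i \<in> ?V2 \<Longrightarrow> j \<in> ?V2 \<Longrightarrow> num_edges G2 i j = num_edges G2 j i"
    and deg2: "\<And>i. i \<in> ?V2 \<Longrightarrow> (\<Sum>j\<in>?V2. num_edges G2 i j) = d2"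
    using G1 G2 by (auto simp: regular_def is_multigraph_def vertex_degree_def)
  have sym: "?c u v i j = ?c v u j i" if "u \<in> ?V1" "v \<in> ?V1" for u v i j
  proof (rule sum.reindex_bij_witness[of _ bar bar])
    fix e assume "e \<in> copies G1 u v"
    then show "bar (bar e) = e" "bar e \<in> copies G1 v u"
      using bar that unfolding edge_pairing_def by blast+
    then show "of_bool (j = \<pi> v (bar e)) * of_bool (i = \<pi> u (bar (bar e)))
        = of_bool (i = \<pi> u e) * (of_bool (j = \<pi> v (bar e)) :: nat)"
      by (simp only: mult.commute)
  next
    fix e assume "e \<in> copies G1 v u"
    then show "bar (bar e) = e" "bar e \<in> copies G1 u v"
      using bar that unfolding edge_pairing_def by blast+
  qed
  have deg: "(\<Sum>v\<in>?V1. \<Sum>j\<in>?V2. ?c u v i j) = 1" if u: "u \<in> ?V1" and i: "i \<in> ?V2" for u i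
  proof -
    have 1: "(\<Sum>j\<in>?V2. ?c u v i j) = (\<Sum>e\<in>copies G1 u v. of_bool (i = \<pi> u e))"
      if v: "v \<in> ?V1" for v
    proof -
      have mem: "\<pi> v (bar e) \<in> ?V2" if "e \<in> copies G1 u v" for e
      proof -
        have "bar e \<in> copies_from G1 v"
          using bar u v that unfolding edge_pairing_def copies_from_def by blast
        then show ?thesis
          using lab v unfolding edge_labeling_def by (blast intro: bij_betwE[THEN bspec])
      qed
      have "(\<Sum>j\<in>?V2. ?c u v i j)
          = (\<Sum>e\<in>copies G1 u v. of_bool (i = \<pi> u e) * (\<Sum>j\<in>?V2. of_bool (j = \<pi> v (bar e))))"
        by (subst sum.swap) (simp only: sum_distrib_left)
      also have "\<dots> = (\<Sum>e\<in>copies G1 u v. of_bool (i = \<pi> u e))"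
        using fin mem by (intro sum.cong) (auto simp: of_bool_def sum.delta)
      finally show ?thesis .
    qed
    have "(\<Sum>v\<in>?V1. \<Sum>j\<in>?V2. ?c u v i j)
        = (\<Sum>v\<in>?V1. \<Sum>e\<in>copies G1 u v. of_bool (i = \<pi> u e))"
      using 1 by (intro sum.cong) auto
    also have "\<dots> = (\<Sum>e\<in>copies_from G1 u. of_bool (i = \<pi> u e))"
      unfolding copies_from_def
      by (rule sum.UNION_disjoint[symmetric]) (use fin in \<open>auto simp: finite_copies copies_def\<close>)
    also have "\<dots> = (\<Sum>k\<in>?V2. of_bool (i = k))"
      by (rule sum.reindex_bij_betw) (use lab u in \<open>auto simp: edge_labeling_def\<close>)
    also have "\<dots> = 1"
      using fin i by (simp add: of_bool_def)
    finally show ?thesis .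
  qed
  have loc: "(\<Sum>v\<in>?V1. \<Sum>j\<in>?V2. num_edges G2 i j * of_bool (u = v)) = d2"
    if u: "u \<in> ?V1" and i: "i \<in> ?V2" for u i
  proof -
    have "(\<Sum>v\<in>?V1. \<Sum>j\<in>?V2. num_edges G2 i j * of_bool (u = v))
        = (\<Sum>v\<in>?V1. if u = v then d2 else 0)"
      using deg2[OF i] by (intro sum.cong) auto
    then show ?thesis using fin u by simp
  qed
  let ?P = "replacement_product G1 G2 bar \<pi>"
  have V: "verts ?P = ?V1 \<times> ?V2"
    and m: "\<And>u i v j. num_edges ?P (u, i) (v, j) = num_edges G2 i j * of_bool (u = v) + ?c u v i j"
    by (simp_all only: replacement_product_def multigraph.simps prod.case)
  have "vertex_degree ?P (u, i) = d2 + 1" if "u \<in> ?V1" "i \<in> ?V2" for u i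
  proof -
    have "vertex_degree ?P (u, i) = (\<Sum>v\<in>?V1. \<Sum>j\<in>?V2. num_edges ?P (u, i) (v, j))"
      unfolding vertex_degree_def V by (simp only: sum.cartesian_product case_prod_eta)
    also have "\<dots> = d2 + 1"
      by (simp only: m sum.distrib loc[OF that] deg[OF that])
    finally show ?thesis .
  qed
  moreover have "is_multigraph ?P"
  proof -
    have "num_edges ?P (u, i) (v, j) = num_edges ?P (v, j) (u, i)"
      if "u \<in> ?V1" "v \<in> ?V1" "i \<in> ?V2" "j \<in> ?V2" for u v i j
      unfolding m sym[OF that(1,2)] sym2[OF that(3,4)] by (simp only: eq_commute[of u v])
    then show ?thesis
      using fin by (simp add: is_multigraph_def V)
  qed
  ultimately show ?thesis
    by (simp add: regular_def V)
qed

end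

theory Submission
  imports Defs
begin

text \<open>
  Apply the Poincare inequality of \<open>G1\<close> once and that of \<open>G2\<close> twice to bound the average of
  \<open>dX x y powr p\<close> by its average over the pairs that are joined by a zigzag path: a step of \<open>G2\<close>, a step along
  an edge of \<open>G1\<close>, and another step of \<open>G2\<close>.  The triangle inequality splits such a path into three
  edges of the replacement product, the first and last of which are edges of \<open>G2\<close>; convexity
  of the \<open>p\<close>-th power contributes the factor \<open>3 powr (p - 1)\<close>.  The factor
  \<open>2\<close> that arises from having two steps in \<open>G2\<close> is absorbed when \<open>d2 \<ge> 2\<close>; for \<open>d2 = 1\<close>
  a finite Poincare constant forces \<open>G2\<close> to be a single vertex (unless \<open>X\<close> has at most one
  point), and then the steps in \<open>G2\<close> are not needed at all.
\<close>

section \<open>Convexity of powers\<close>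

text \<open>Only the endpoint 0 goes beyond convexity on the positive reals: there the claim becomes
  \<open>(t * x) powr p \<le> t * x powr p\<close>, true because \<open>t powr p \<le> t\<close> for
  \<open>t\<close> between 0 and 1.\<close>

lemma convex_on_powr_atLeast:
  fixes p :: real
  assumes "1 \<le> p"
  shows "convex_on {0..} (\<lambda>x. x powr p)"
proof (rule convex_onI)
  have scale: "(t * x) powr p \<le> t * x powr p" if "0 < t" "t < 1" "0 \<le> x" for t x :: real
  proof -
    have "t powr p \<le> t powr 1"
      using that assms by (intro powr_mono') auto
    then show ?thesis
      using that by (simp add: powr_mult mult_right_mono)
  qed
  fix t x y :: real
  assume t: "0 < t" "t < 1" and xy: "x \<in> {0..}" "y \<in> {0..}"
  consider "x = 0" | "y = 0" | "0 < x" "0 < y"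
    using xy by fastforce
  then show "((1 - t) *\<^sub>R x + t *\<^sub>R y) powr p \<le> (1 - t) * x powr p + t * y powr p"
  proof cases
    case 3
    then show ?thesis
      using convex_onD[OF powr_convex[OF assms], of t x y] t by simp
  qed (use t xy scale[of t y] scale[of "1 - t" x] in auto)
qed simp

text \<open>Jensen's inequality with three weights \<open>1/3\<close>; multiplying by
  \<open>3 powr p\<close> leaves the constant \<open>3 powr p / 3\<close>.\<close>

lemma powr_add3_le:
  fixes a b c p :: real
  assumes "1 \<le> p" "0 \<le> a" "0 \<le> b" "0 \<le> c"
  shows "(a + b + c) powr p \<le> 3 powr (p - 1) * (a powr p + b powr p + c powr p)"
proof -
  let ?y = "\<lambda>i::nat. if i = 0 then a else if i = 1 then b else c"
  have "(\<Sum>i\<in>{0,1,2::nat}. (1/3) *\<^sub>R ?y i) powr p \<le> (\<Sum>i\<in>{0,1,2::nat}. 1/3 * ?y i powr p)"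
    using assms by (intro convex_on_sum[OF _ _ convex_on_powr_atLeast]) auto
  then have "((a + b + c) / 3) powr p \<le> (a powr p + b powr p + c powr p) / 3"
    by (simp add: field_simps)
  then show ?thesis
    using assms by (simp add: powr_divide powr_diff field_simps)
qed

section \<open>Poincare constants\<close>

text \<open>The condition under the infimum in \<open>gamma_plus\<close>, apart from the positivity
  of \<open>g\<close>; the combinatorial argument works with one real constant rather than with an
  infimum in \<open>ennreal\<close>.\<close>

definition poincare_ineq ::
  "'i set \<Rightarrow> ('i \<Rightarrow> 'i \<Rightarrow> real) \<Rightarrow> 'a set \<Rightarrow> ('a \<Rightarrow> 'a \<Rightarrow> real) \<Rightarrow> real \<Rightarrow> bool" where
  "poincare_ineq I A X K g \<longleftrightarrow>
     (\<forall>x \<in> I \<rightarrow> X. \<forall>y \<in> I \<rightarrow> X.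
        1 / (real (card I))\<^sup>2 * (\<Sum>i\<in>I. \<Sum>j\<in>I. K (x i) (y j))
        \<le> g / real (card I) * (\<Sum>i\<in>I. \<Sum>j\<in>I. A i j * K (x i) (y j)))"

lemma gamma_plus_le:
  assumes "0 < g" "poincare_ineq I A X K g"
  shows "gamma_plus I A X K \<le> ennreal g"
  unfolding gamma_plus_def
  by (rule Inf_lower) (use assms in \<open>auto simp: poincare_ineq_def\<close>)

text \<open>Both sides of the inequality vanish, so every positive constant is admissible. This
  disposes of empty graphs and of spaces with at most one point.\<close>

lemma gamma_plus_eq_0:
  assumes "I = {} \<or> (\<forall>a\<in>X. \<forall>b\<in>X. K a b = 0)"
  shows "gamma_plus I A X K = 0"
proof -
  have "gamma_plus I A X K \<le> ennreal g" if "0 < g" for g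
  proof (rule gamma_plus_le[OF that], unfold poincare_ineq_def, intro ballI)
    fix x y assume xy: "x \<in> I \<rightarrow> X" "y \<in> I \<rightarrow> X"
    have "K (x i) (y j) = 0" if "i \<in> I" "j \<in> I" for i j
      using assms xy that by (auto simp: Pi_iff)
    then show "1 / (real (card I))\<^sup>2 * (\<Sum>i\<in>I. \<Sum>j\<in>I. K (x i) (y j))
        \<le> g / real (card I) * (\<Sum>i\<in>I. \<Sum>j\<in>I. A i j * K (x i) (y j))"
      by simp
  qed
  then have "gamma_plus I A X K \<le> 0 + ennreal e" if "0 < e" for e
    using that by simp
  then have "gamma_plus I A X K \<le> 0"
    by (rule ennreal_le_epsilon)
  then show ?thesis by simp
qed

lemma poincare_ineq_mono:
  assumes "poincare_ineq I A X K g" "g \<le> g'"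
    and "\<And>i j. i \<in> I \<Longrightarrow> j \<in> I \<Longrightarrow> 0 \<le> A i j" and "\<And>a b. 0 \<le> K a b"
  shows "poincare_ineq I A X K g'"
  unfolding poincare_ineq_def
proof (intro ballI)
  fix x y assume xy: "x \<in> I \<rightarrow> X" "y \<in> I \<rightarrow> X"
  have "1 / (real (card I))\<^sup>2 * (\<Sum>i\<in>I. \<Sum>j\<in>I. K (x i) (y j))
      \<le> g / real (card I) * (\<Sum>i\<in>I. \<Sum>j\<in>I. A i j * K (x i) (y j))"
    using assms(1) xy unfolding poincare_ineq_def by blast
  also have "\<dots> \<le> g' / real (card I) * (\<Sum>i\<in>I. \<Sum>j\<in>I. A i j * K (x i) (y j))"
    using assms by (intro mult_right_mono divide_right_mono sum_nonneg) auto
  finally show "1 / (real (card I))\<^sup>2 * (\<Sum>i\<in>I. \<Sum>j\<in>I. K (x i) (y j))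
      \<le> g' / real (card I) * (\<Sum>i\<in>I. \<Sum>j\<in>I. A i j * K (x i) (y j))" .
qed

text \<open>Some admissible constant lies below \<open>r + e\<close>, and admissibility is monotone
  in the constant. The slack \<open>e\<close> spares a proof that the infimum is attained; a limit
  removes it at the very end.\<close>

lemma gamma_plus_finiteE:
  assumes "gamma_plus I A X K \<noteq> top"
    and A: "\<And>i j. i \<in> I \<Longrightarrow> j \<in> I \<Longrightarrow> 0 \<le> A i j" and K: "\<And>a b. 0 \<le> K a b"
  obtains r where "0 \<le> r" "gamma_plus I A X K = ennreal r"
    "\<And>e. 0 < e \<Longrightarrow> poincare_ineq I A X K (r + e)"
proof
  let ?r = "enn2real (gamma_plus I A X K)"
  show "0 \<le> ?r" by simp
  show eq: "gamma_plus I A X K = ennreal ?r"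
    using assms(1) by (simp add: less_top)
  fix e :: real assume "0 < e"
  then have "gamma_plus I A X K < ennreal (?r + e)"
    by (subst eq) (simp add: ennreal_less_iff)
  then obtain g where g: "0 < g" "ennreal g < ennreal (?r + e)" "poincare_ineq I A X K g"
    unfolding gamma_plus_def Inf_less_iff by (auto simp: poincare_ineq_def)
  then have "g \<le> ?r + e"
    by (simp add: ennreal_less_iff)
  then show "poincare_ineq I A X K (?r + e)"
    using poincare_ineq_mono[OF g(3) _ A K] by blast
qed

text \<open>Testing with the constant maps \<open>a\<close> and \<open>b\<close> bounds admissible
  constants from below in terms of the average row sum of \<open>A\<close>, provided
  \<open>K a b\<close> is positive.\<close>

lemma poincare_ineq_const:
  assumes "poincare_ineq I A X K g" "finite I" "I \<noteq> {}" "a \<in> X" "b \<in> X"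
  shows "K a b \<le> g * ((\<Sum>i\<in>I. \<Sum>j\<in>I. A i j) * K a b) / card I"
proof -
  have "1 / (real (card I))\<^sup>2 * (\<Sum>i\<in>I. \<Sum>j\<in>I. K a b)
      \<le> g / real (card I) * (\<Sum>i\<in>I. \<Sum>j\<in>I. A i j * K a b)"
    using assms(1,4,5) unfolding poincare_ineq_def
    by (elim ballE[of _ _ "\<lambda>_. a"] ballE[of _ _ "\<lambda>_. b"]) auto
  then show ?thesis
    using assms(2,3) by (simp add: sum_distrib_right power2_eq_square)
qed

lemma gamma_plus_nonzero:
  assumes "finite I" "I \<noteq> {}" "a \<in> X" "b \<in> X" "K a b \<noteq> 0"
    and A: "\<And>i j. i \<in> I \<Longrightarrow> j \<in> I \<Longrightarrow> 0 \<le> A i j" and K: "\<And>a b. 0 \<le> K a b"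
  shows "gamma_plus I A X K \<noteq> 0"
proof
  assume 0: "gamma_plus I A X K = 0"
  obtain r where r: "0 \<le> r" "gamma_plus I A X K = ennreal r"
    "\<And>e. 0 < e \<Longrightarrow> poincare_ineq I A X K (r + e)"
    by (rule gamma_plus_finiteE[of I A X K]) (use 0 A K in auto)
  then have "poincare_ineq I A X K e" if "0 < e" for e
    using 0 that by fastforce
  let ?M = "(\<Sum>i\<in>I. \<Sum>j\<in>I. A i j) / card I"
  have M: "0 \<le> ?M" using A by (intro divide_nonneg_nonneg sum_nonneg) auto
  \<comment> \<open>For \<open>g = 1 / (?M + 1)\<close> the product \<open>g * ?M\<close> is below
    1, so constant maps violate the inequality. The added 1 also covers
    \<open>?M = 0\<close>.\<close>
  have "K a b \<le> 1 / (?M + 1) * ((\<Sum>i\<in>I. \<Sum>j\<in>I. A i j) * K a b) / card I"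
    using M assms(1-4) \<open>\<And>e. 0 < e \<Longrightarrow> poincare_ineq I A X K e\<close>
    by (intro poincare_ineq_const[where X = X]) auto
  also have "\<dots> = ?M * K a b / (?M + 1)" by simp
  finally have "K a b * (?M + 1) \<le> ?M * K a b"
    using M by (subst (asm) pos_le_divide_eq) simp_all
  then have "K a b \<le> 0" by (simp add: algebra_simps)
  then show False using K[of a b] assms(5) by simp
qed

text \<open>Multiplying by \<open>n\<^sup>2 * d\<close>, with \<open>n\<close> the number of
  vertices, clears the denominators. The edge sums then carry integer multiplicities and can be
  rewritten as sums over edge copies.\<close>

lemma poincare_ineq_regular_iff:
  fixes K :: "'a \<Rightarrow> 'a \<Rightarrow> real"
  assumes "regular d G" "0 < d" "verts G \<noteq> {}"
  shows "poincare_ineq (verts G) (normalized_adjacency G) X K g \<longleftrightarrow>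
    (\<forall>x \<in> verts G \<rightarrow> X. \<forall>y \<in> verts G \<rightarrow> X.
       real d * (\<Sum>i\<in>verts G. \<Sum>j\<in>verts G. K (x i) (y j))
       \<le> g * real (card (verts G)) * (\<Sum>i\<in>verts G. \<Sum>j\<in>verts G. num_edges G i j * K (x i) (y j)))"
proof -
  let ?V = "verts G"
  have n: "0 < real (card ?V)"
    using assms by (auto simp: regular_def is_multigraph_def card_gt_0_iff)
  have *: "(\<Sum>i\<in>?V. \<Sum>j\<in>?V. normalized_adjacency G i j * K (x i) (y j))
      = (\<Sum>i\<in>?V. \<Sum>j\<in>?V. num_edges G i j * K (x i) (y j)) / d" for x y
    using assms(1)
    by (auto simp: normalized_adjacency_def regular_def sum_divide_distrib intro!: sum.cong)
  have "1 / n\<^sup>2 * S \<le> g / n * (T / real d) \<longleftrightarrow> real d * S \<le> g * n * T" if "0 < n" for S T n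
  proof -
    have "1 / n\<^sup>2 * S \<le> g / n * (T / real d)
        \<longleftrightarrow> n\<^sup>2 * d * (1 / n\<^sup>2 * S) \<le> n\<^sup>2 * d * (g / n * (T / real d))"
      using that assms(2) by (intro mult_le_cancel_left_pos[symmetric]) simp
    also have "\<dots> \<longleftrightarrow> real d * S \<le> g * n * T"
      using that assms(2) by (simp add: power2_eq_square mult_ac)
    finally show ?thesis .
  qed
  then show ?thesis
    unfolding poincare_ineq_def * using n by simp
qed

lemma normalized_adjacency_nonneg: "0 \<le> normalized_adjacency G u v"
  by (simp add: normalized_adjacency_def)

section \<open>Edge copies and the rotation map\<close>

lemma sum_copies_from:
  assumes "finite (verts G)"
  shows "(\<Sum>v\<in>verts G. \<Sum>e\<in>copies G u v. h e) = (\<Sum>e\<in>copies_from G u. h e)"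
  unfolding copies_from_def
  by (rule sum.UNION_disjoint[symmetric]) (use assms in \<open>auto simp: finite_copies copies_def\<close>)

lemma card_copies: "card (copies G u v) = num_edges G u v"
proof -
  have "copies G u v = (\<lambda>k. (u, v, k)) ` {..<num_edges G u v}"
    by (auto simp: copies_def)
  then show ?thesis by (simp add: card_image inj_on_def)
qed

text \<open>Here \<open>fst (snd e)\<close> is the head of the copy \<open>e\<close>. The semiring
  is general because \<open>H = 1\<close> over \<open>nat\<close> counts the copies leaving
  \<open>u\<close>, while real \<open>H\<close> serves the edge sums.\<close>

lemma sum_num_edges_eq_sum_copies_from:
  fixes H :: "'v \<Rightarrow> 'b::comm_semiring_1"
  assumes "finite (verts G)"
  shows "(\<Sum>v\<in>verts G. of_nat (num_edges G u v) * H v)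
    = (\<Sum>e\<in>copies_from G u. H (fst (snd e)))"
proof -
  have "(\<Sum>e\<in>copies G u v. H (fst (snd e))) = of_nat (num_edges G u v) * H v" for v
  proof -
    have "(\<Sum>e\<in>copies G u v. H (fst (snd e))) = (\<Sum>e\<in>copies G u v. H v)"
      by (intro sum.cong) (auto simp: copies_def)
    then show ?thesis by (simp add: card_copies)
  qed
  then show ?thesis
    by (simp flip: sum_copies_from[OF assms])
qed

text \<open>Exactly \<open>d\<close> edge copies leave each vertex, and \<open>nb u s\<close> is the
  head of the copy numbered \<open>s\<close>. Repeated values encode multiplicities, so a step in
  the graph becomes an unweighted sum over \<open>s < d\<close>.\<close>

lemma neighbour_enumeration:
  assumes "regular d G"
  obtains nb where "\<And>u s. u \<in> verts G \<Longrightarrow> s < d \<Longrightarrow> nb u s \<in> verts G"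
    "\<And>u (H::_ \<Rightarrow> real). u \<in> verts G \<Longrightarrow>
       (\<Sum>v\<in>verts G. num_edges G u v * H v) = (\<Sum>s<d. H (nb u s))"
proof -
  have fin: "finite (verts G)"
    using assms by (simp add: regular_def is_multigraph_def)
  have "\<exists>b. bij_betw b {..<d} (copies_from G u)" if "u \<in> verts G" for u
  proof -
    have "card (copies_from G u) = d"
      using sum_num_edges_eq_sum_copies_from[OF fin, of u "\<lambda>_. 1::nat"] assms that
      by (simp add: regular_def vertex_degree_def)
    moreover have "finite (copies_from G u)"
      using fin by (simp add: copies_from_def finite_copies)
    ultimately show ?thesis
      by (metis ex_bij_betw_nat_finite lessThan_atLeast0)
  qed
  then obtain b where b: "\<And>u. u \<in> verts G \<Longrightarrow> bij_betw (b u) {..<d} (copies_from G u)"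
    by metis
  show ?thesis
  proof
    show "fst (snd (b u s)) \<in> verts G" if "u \<in> verts G" "s < d" for u s
      using bij_betwE[OF b[OF that(1)]] that(2) by (force simp: copies_from_def copies_def)
    show "(\<Sum>v\<in>verts G. num_edges G u v * H v) = (\<Sum>s<d. H (fst (snd (b u s))))"
      if "u \<in> verts G" for u and H :: "_ \<Rightarrow> real"
      using sum_num_edges_eq_sum_copies_from[OF fin, of u H]
        sum.reindex_bij_betw[OF b[OF that], of "\<lambda>e. H (fst (snd e))"] by simp
  qed
qed

text \<open>The rotation map known from expander constructions: leave \<open>u\<close> through the
  copy labelled \<open>i\<close>, then record the vertex \<open>v\<close> reached and the label at
  \<open>v\<close> of the reversed copy.\<close>

definition rotation_map ::
  "'v multigraph \<Rightarrow> ('v edge_copy \<Rightarrow> 'v edge_copy) \<Rightarrow> ('v \<Rightarrow> 'v edge_copy \<Rightarrow> 'w) \<Rightarrow>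
   'v \<times> 'w \<Rightarrow> 'v \<times> 'w" where
  "rotation_map G bar \<pi> = (\<lambda>(u, i).
     let e = inv_into (copies_from G u) (\<pi> u) i; v = fst (snd e) in (v, \<pi> v (bar e)))"

context
  fixes G1 :: "'v multigraph" and G2 :: "'w multigraph"
    and bar :: "'v edge_copy \<Rightarrow> 'v edge_copy" and \<pi> :: "'v \<Rightarrow> 'v edge_copy \<Rightarrow> 'w"
  assumes fin: "finite (verts G1)" "finite (verts G2)"
    and bar: "edge_pairing G1 bar" and lab: "edge_labeling G1 G2 \<pi>"
begin

lemma labeling_bij: "u \<in> verts G1 \<Longrightarrow> bij_betw (\<pi> u) (copies_from G1 u) (verts G2)"
  using lab by (simp add: edge_labeling_def)

lemma rotation_map_label:
  assumes "u \<in> verts G1" "e \<in> copies G1 u v" "v \<in> verts G1"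
  shows "rotation_map G1 bar \<pi> (u, \<pi> u e) = (v, \<pi> v (bar e))"
proof -
  have "e \<in> copies_from G1 u" using assms by (auto simp: copies_from_def)
  then have "inv_into (copies_from G1 u) (\<pi> u) (\<pi> u e) = e"
    using labeling_bij[OF assms(1)] by (simp add: bij_betw_inv_into_left)
  then show ?thesis using assms by (auto simp: rotation_map_def copies_def)
qed

lemma labelE:
  assumes "u \<in> verts G1" "i \<in> verts G2"
  obtains v e where "v \<in> verts G1" "e \<in> copies G1 u v" "i = \<pi> u e"
  using labeling_bij[OF assms(1)] assms(2) unfolding bij_betw_def copies_from_def by blast

lemma label_in_verts:
  assumes "u \<in> verts G1" "v \<in> verts G1" "e \<in> copies G1 u v"
  shows "\<pi> u e \<in> verts G2"
  using bij_betwE[OF labeling_bij[OF assms(1)]] assms unfolding copies_from_def by blast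

text \<open>The label reached at \<open>v\<close> determines the copy \<open>bar e\<close>, whose
  reversal is \<open>e\<close> again, so a second application walks the same edge back.\<close>

lemma rotation_map_involution:
  assumes "w \<in> verts G1 \<times> verts G2"
  shows "rotation_map G1 bar \<pi> w \<in> verts G1 \<times> verts G2"
    "rotation_map G1 bar \<pi> (rotation_map G1 bar \<pi> w) = w"
proof -
  obtain u i where w: "w = (u, i)" "u \<in> verts G1" "i \<in> verts G2" using assms by auto
  obtain v e where e: "v \<in> verts G1" "e \<in> copies G1 u v" "i = \<pi> u e"
    using labelE w by metis
  have be: "bar e \<in> copies G1 v u" "bar (bar e) = e"
    using bar w e unfolding edge_pairing_def by blast+
  show "rotation_map G1 bar \<pi> w \<in> verts G1 \<times> verts G2"
    using w e be label_in_verts by (simp add: rotation_map_label)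
  show "rotation_map G1 bar \<pi> (rotation_map G1 bar \<pi> w) = w"
    using w e be rotation_map_label[of u e v] rotation_map_label[of v "bar e" u] by simp
qed

text \<open>The labels at \<open>u\<close> parametrize the copies leaving \<open>u\<close>
  bijectively; \<open>h\<close> receives the label at \<open>u\<close>, the head, and the label at
  the head.\<close>

lemma sum_copies_rotation:
  assumes "u \<in> verts G1"
  shows "(\<Sum>v\<in>verts G1. \<Sum>e\<in>copies G1 u v. h (\<pi> u e) v (\<pi> v (bar e)))
    = (\<Sum>k\<in>verts G2. h k (fst (rotation_map G1 bar \<pi> (u, k))) (snd (rotation_map G1 bar \<pi> (u, k))))"
    (is "_ = (\<Sum>k\<in>_. ?h k)")
proof -
  have "(\<Sum>v\<in>verts G1. \<Sum>e\<in>copies G1 u v. h (\<pi> u e) v (\<pi> v (bar e)))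
      = (\<Sum>v\<in>verts G1. \<Sum>e\<in>copies G1 u v. ?h (\<pi> u e))"
    using assms by (intro sum.cong refl) (simp add: rotation_map_label)
  also have "\<dots> = (\<Sum>e\<in>copies_from G1 u. ?h (\<pi> u e))"
    by (rule sum_copies_from[OF fin(1)])
  also have "\<dots> = (\<Sum>k\<in>verts G2. ?h k)"
    by (rule sum.reindex_bij_betw[OF labeling_bij[OF assms]])
  finally show ?thesis .
qed

lemma sum_num_edges_rotation:
  fixes H :: "'v \<Rightarrow> real"
  assumes "u \<in> verts G1"
  shows "(\<Sum>v\<in>verts G1. num_edges G1 u v * H v)
    = (\<Sum>k\<in>verts G2. H (fst (rotation_map G1 bar \<pi> (u, k))))"
  using sum_copies_rotation[OF assms, of "\<lambda>k v l. H v"] by (simp add: card_copies)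

text \<open>Besides the \<open>G2\<close> edges inside the cloud over \<open>u\<close>, that is, the
  copy of \<open>G2\<close> placed there, the vertex \<open>(u, i)\<close> has exactly one further
  edge: the \<open>G1\<close> edge labelled \<open>i\<close> at \<open>u\<close>.\<close>

lemma sum_num_edges_replacement_product:
  fixes H :: "'v \<times> 'w \<Rightarrow> real"
  assumes u: "u \<in> verts G1" and i: "i \<in> verts G2"
  shows "(\<Sum>w\<in>verts G1 \<times> verts G2. num_edges (replacement_product G1 G2 bar \<pi>) (u, i) w * H w)
    = (\<Sum>j\<in>verts G2. num_edges G2 i j * H (u, j)) + H (rotation_map G1 bar \<pi> (u, i))"
proof -
  let ?V1 = "verts G1" and ?V2 = "verts G2"
  have local: "(\<Sum>v\<in>?V1. \<Sum>j\<in>?V2. real (num_edges G2 i j * of_bool (u = v)) * H (v, j))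
      = (\<Sum>j\<in>?V2. num_edges G2 i j * H (u, j))"
  proof -
    have "(\<Sum>v\<in>?V1. \<Sum>j\<in>?V2. real (num_edges G2 i j * of_bool (u = v)) * H (v, j))
        = (\<Sum>v\<in>?V1. if u = v then \<Sum>j\<in>?V2. num_edges G2 i j * H (u, j) else 0)"
      by (intro sum.cong) auto
    then show ?thesis using fin u by simp
  qed
  have cross: "(\<Sum>v\<in>?V1. \<Sum>j\<in>?V2.
        real (\<Sum>e\<in>copies G1 u v. of_bool (i = \<pi> u e) * of_bool (j = \<pi> v (bar e))) * H (v, j))
      = H (rotation_map G1 bar \<pi> (u, i))"
  proof -
    have "(\<Sum>j\<in>?V2.
          real (\<Sum>e\<in>copies G1 u v. of_bool (i = \<pi> u e) * of_bool (j = \<pi> v (bar e))) * H (v, j))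
        = (\<Sum>e\<in>copies G1 u v. of_bool (i = \<pi> u e) * H (v, \<pi> v (bar e)))" if v: "v \<in> ?V1" for v
    proof -
      have mem: "\<pi> v (bar e) \<in> ?V2" if "e \<in> copies G1 u v" for e
        using bar u v that label_in_verts unfolding edge_pairing_def by blast
      have "(\<Sum>j\<in>?V2.
          real (\<Sum>e\<in>copies G1 u v. of_bool (i = \<pi> u e) * of_bool (j = \<pi> v (bar e))) * H (v, j))
          = (\<Sum>e\<in>copies G1 u v. \<Sum>j\<in>?V2.
              of_bool (i = \<pi> u e) * (if j = \<pi> v (bar e) then H (v, j) else 0))"
        by (subst sum.swap) (auto simp: sum_distrib_right intro!: sum.cong)
      also have "\<dots> = (\<Sum>e\<in>copies G1 u v. of_bool (i = \<pi> u e) * H (v, \<pi> v (bar e)))"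
        using fin mem by (intro sum.cong refl) (simp add: sum_distrib_left[symmetric])
      finally show ?thesis .
    qed
    then have "(\<Sum>v\<in>?V1. \<Sum>j\<in>?V2.
        real (\<Sum>e\<in>copies G1 u v. of_bool (i = \<pi> u e) * of_bool (j = \<pi> v (bar e))) * H (v, j))
        = (\<Sum>v\<in>?V1. \<Sum>e\<in>copies G1 u v. of_bool (i = \<pi> u e) * H (v, \<pi> v (bar e)))"
      by (intro sum.cong) auto
    also have "\<dots> = (\<Sum>k\<in>?V2. if k = i then H (rotation_map G1 bar \<pi> (u, k)) else 0)"
      by (subst sum_copies_rotation[OF u, of "\<lambda>k v l. of_bool (i = k) * H (v, l)"])
        (auto intro!: sum.cong)
    finally show ?thesis using fin i by simp
  qed
  have "(\<Sum>w\<in>?V1 \<times> ?V2. num_edges (replacement_product G1 G2 bar \<pi>) (u, i) w * H w)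
      = (\<Sum>v\<in>?V1. \<Sum>j\<in>?V2. num_edges (replacement_product G1 G2 bar \<pi>) (u, i) (v, j) * H (v, j))"
    by (rule sum.cartesian_product')
  also have "\<dots> = (\<Sum>j\<in>?V2. num_edges G2 i j * H (u, j)) + H (rotation_map G1 bar \<pi> (u, i))"
    unfolding replacement_product_def multigraph.simps prod.case of_nat_add distrib_right
      sum.distrib local cross ..
  finally show ?thesis .
qed

end

section \<open>Zigzag paths\<close>

text \<open>Zigzag paths see \<open>G1\<close> only through an involution \<open>rot\<close> and
  \<open>G2\<close> only through an enumeration \<open>nb\<close> of neighbours. The assumption
  \<open>nb_sym\<close> is the symmetry of the multiplicities of \<open>G2\<close>, expressed
  without them.\<close>

context
  fixes V1 :: "'v set" and V2 :: "'w set" and d2 :: nat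
    and rot :: "'v \<times> 'w \<Rightarrow> 'v \<times> 'w" and nb :: "'w \<Rightarrow> nat \<Rightarrow> 'w"
  assumes fin: "finite V1" "finite V2"
    and rot: "\<And>w. w \<in> V1 \<times> V2 \<Longrightarrow> rot w \<in> V1 \<times> V2" "\<And>w. w \<in> V1 \<times> V2 \<Longrightarrow> rot (rot w) = w"
    and nb: "\<And>i s. i \<in> V2 \<Longrightarrow> s < d2 \<Longrightarrow> nb i s \<in> V2"
    and nb_sym: "\<And>H :: 'w \<Rightarrow> 'w \<Rightarrow> real.
      (\<Sum>i\<in>V2. \<Sum>s<d2. H (nb i s) i) = (\<Sum>i\<in>V2. \<Sum>s<d2. H i (nb i s))"
begin

lemma sum_rot: "(\<Sum>w\<in>V1 \<times> V2. h (rot w) w) = (\<Sum>w\<in>V1 \<times> V2. h w (rot w) :: real)"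
  by (rule sum.reindex_bij_witness[of _ rot rot]) (use rot in auto)

text \<open>Each term belongs to one zigzag path: its middle edge joins \<open>w\<close> to
  \<open>rot w\<close>, and \<open>t\<close> and \<open>s\<close> number the \<open>G2\<close> steps
  at these two ends.\<close>

definition zigzag_sum :: "('a \<Rightarrow> 'a \<Rightarrow> real) \<Rightarrow> ('v \<times> 'w \<Rightarrow> 'a) \<Rightarrow> ('v \<times> 'w \<Rightarrow> 'a) \<Rightarrow> real" where
  "zigzag_sum K f g = (\<Sum>w\<in>V1 \<times> V2. \<Sum>s<d2. \<Sum>t<d2.
     K (f (fst (rot w), nb (snd (rot w)) s)) (g (fst w, nb (snd w) t)))"

text \<open>\<open>P1\<close> acts on first coordinates with the labels frozen, then
  \<open>P2\<close> acts once at each end of the resulting edge. The left side gains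
  \<open>card V2 * d2\<^sup>2\<close> and the right side \<open>card V1 * (card V2)\<^sup>2\<close>;
  cancelling \<open>card V2\<close> leaves \<open>card (V1 \<times> V2)\<close>.\<close>

lemma zigzag_poincare:
  fixes K :: "'a \<Rightarrow> 'a \<Rightarrow> real" and X :: "'a set" and g1 g2 :: real
  assumes "V2 \<noteq> {}" and g: "0 \<le> g1" "0 \<le> g2"
    and P1: "\<And>x y. x \<in> V1 \<rightarrow> X \<Longrightarrow> y \<in> V1 \<rightarrow> X \<Longrightarrow>
      real (card V2) * (\<Sum>u\<in>V1. \<Sum>v\<in>V1. K (x u) (y v))
        \<le> g1 * card V1 * (\<Sum>u\<in>V1. \<Sum>k\<in>V2. K (x u) (y (fst (rot (u, k)))))"
    and P2: "\<And>x y. x \<in> V2 \<rightarrow> X \<Longrightarrow> y \<in> V2 \<rightarrow> X \<Longrightarrow>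
      real d2 * (\<Sum>i\<in>V2. \<Sum>j\<in>V2. K (x i) (y j))
        \<le> g2 * card V2 * (\<Sum>i\<in>V2. \<Sum>s<d2. K (x i) (y (nb i s)))"
    and f: "f \<in> V1 \<times> V2 \<rightarrow> X" and h: "h \<in> V1 \<times> V2 \<rightarrow> X"
  shows "(real d2)\<^sup>2 * (\<Sum>w\<in>V1 \<times> V2. \<Sum>w'\<in>V1 \<times> V2. K (f w) (h w'))
    \<le> g1 * g2\<^sup>2 * card (V1 \<times> V2) * zigzag_sum K f h"
proof -
  have fin': "fst (rot (u, k)) \<in> V1" "snd (rot (u, k)) \<in> V2" if "u \<in> V1" "k \<in> V2" for u k
    using rot(1)[of "(u, k)"] that by (auto simp: mem_Times_iff)
  let ?n1 = "real (card V1)" and ?n2 = "real (card V2)"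
  \<comment> \<open>In \<open>S0\<close> the two vertices are independent. In \<open>S1\<close> the
    first coordinates are joined by the edge labelled \<open>k\<close> at \<open>u\<close>, with
    \<open>i\<close> and \<open>j\<close> still free; in \<open>S2\<close> the label on the side of
    \<open>f\<close> is a neighbour of \<open>k\<close>.\<close>
  define S0 where "S0 = (\<Sum>w\<in>V1 \<times> V2. \<Sum>w'\<in>V1 \<times> V2. K (f w) (h w'))"
  define S1 where "S1 = (\<Sum>i\<in>V2. \<Sum>j\<in>V2. \<Sum>u\<in>V1. \<Sum>k\<in>V2. K (f (u, i)) (h (fst (rot (u, k)), j)))"
  define S2 where
    "S2 = (\<Sum>j\<in>V2. \<Sum>u\<in>V1. \<Sum>k\<in>V2. \<Sum>s<d2. K (f (u, nb k s)) (h (fst (rot (u, k)), j)))"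
  have "S0 = (\<Sum>i\<in>V2. \<Sum>j\<in>V2. \<Sum>u\<in>V1. \<Sum>v\<in>V1. K (f (u, i)) (h (v, j)))"
  proof -
    have "S0 = (\<Sum>u\<in>V1. \<Sum>i\<in>V2. \<Sum>v\<in>V1. \<Sum>j\<in>V2. K (f (u, i)) (h (v, j)))"
      unfolding S0_def sum.cartesian_product' ..
    also have "\<dots> = (\<Sum>i\<in>V2. \<Sum>u\<in>V1. \<Sum>j\<in>V2. \<Sum>v\<in>V1. K (f (u, i)) (h (v, j)))"
      by (subst sum.swap, intro sum.cong refl sum.swap)
    also have "\<dots> = (\<Sum>i\<in>V2. \<Sum>j\<in>V2. \<Sum>u\<in>V1. \<Sum>v\<in>V1. K (f (u, i)) (h (v, j)))"
      by (intro sum.cong refl sum.swap)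
    finally show ?thesis .
  qed
  then have "?n2 * S0 = (\<Sum>i\<in>V2. \<Sum>j\<in>V2. ?n2 * (\<Sum>u\<in>V1. \<Sum>v\<in>V1. K (f (u, i)) (h (v, j))))"
    by (simp only: sum_distrib_left)
  also have "\<dots> \<le> (\<Sum>i\<in>V2. \<Sum>j\<in>V2. g1 * ?n1 *
      (\<Sum>u\<in>V1. \<Sum>k\<in>V2. K (f (u, i)) (h (fst (rot (u, k)), j))))"
    using f h by (intro sum_mono P1) (auto simp: Pi_iff)
  also have "\<dots> = g1 * ?n1 * S1"
    by (simp only: S1_def sum_distrib_left)
  finally have 1: "?n2 * S0 \<le> g1 * ?n1 * S1" .
  have "S1 = (\<Sum>j\<in>V2. \<Sum>u\<in>V1. \<Sum>i\<in>V2. \<Sum>k\<in>V2. K (f (u, i)) (h (fst (rot (u, k)), j)))"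
    unfolding S1_def by (subst sum.swap, intro sum.cong refl sum.swap)
  then have "real d2 * S1 = (\<Sum>j\<in>V2. \<Sum>u\<in>V1.
      real d2 * (\<Sum>i\<in>V2. \<Sum>k\<in>V2. K (f (u, i)) (h (fst (rot (u, k)), j))))"
    by (simp only: sum_distrib_left)
  \<comment> \<open>For fixed \<open>u\<close> and \<open>j\<close> both arguments of
    \<open>K\<close> are functions of a label: \<open>i\<close> enters through
    \<open>f (u, i)\<close>, and \<open>k\<close> through the vertex reached from
    \<open>(u, k)\<close>.\<close>
  also have "\<dots> \<le> (\<Sum>j\<in>V2. \<Sum>u\<in>V1. g2 * ?n2 *
      (\<Sum>i\<in>V2. \<Sum>s<d2. K (f (u, i)) (h (fst (rot (u, nb i s)), j))))"
    using f h fin' by (intro sum_mono P2) (auto simp: Pi_iff)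
  \<comment> \<open>\<open>P2\<close> puts the \<open>G2\<close> step into the label of the edge;
    \<open>nb_sym\<close> moves it to the argument of \<open>f\<close>, where it is a step inside
    the cloud over \<open>u\<close>.\<close>
  also have "\<dots> = g2 * ?n2 * S2"
    unfolding S2_def sum_distrib_left[symmetric]
    by (subst nb_sym[of "\<lambda>i k. K (f (u, i)) (h (fst (rot (u, k)), j))" for u j]) (rule refl)
  finally have 2: "real d2 * S1 \<le> g2 * ?n2 * S2" .
  have "S2 = (\<Sum>w\<in>V1 \<times> V2. \<Sum>j\<in>V2. \<Sum>s<d2. K (f (fst w, nb (snd w) s)) (h (fst (rot w), j)))"
  proof -
    have "S2 = (\<Sum>j\<in>V2. \<Sum>w\<in>V1 \<times> V2. \<Sum>s<d2. K (f (fst w, nb (snd w) s)) (h (fst (rot w), j)))"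
      unfolding S2_def by (simp add: sum.cartesian_product')
    then show ?thesis by (subst sum.swap)
  qed
  \<comment> \<open>Reading each edge from its other end puts its label and the free label
    \<open>j\<close> into the same cloud, so that \<open>P2\<close> applies a second time, with
    \<open>v\<close> and \<open>s\<close> fixed.\<close>
  also have "\<dots> = (\<Sum>w\<in>V1 \<times> V2. \<Sum>j\<in>V2. \<Sum>s<d2.
      K (f (fst (rot w), nb (snd (rot w)) s)) (h (fst w, j)))"
    by (rule sum_rot[symmetric])
  also have "\<dots> = (\<Sum>v\<in>V1. \<Sum>l\<in>V2. \<Sum>s<d2. \<Sum>j\<in>V2.
      K (f (fst (rot (v, l)), nb (snd (rot (v, l))) s)) (h (v, j)))"
    unfolding sum.cartesian_product' fst_conv snd_conv by (intro sum.cong refl sum.swap)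
  also have "\<dots> = (\<Sum>v\<in>V1. \<Sum>s<d2. \<Sum>l\<in>V2. \<Sum>j\<in>V2.
      K (f (fst (rot (v, l)), nb (snd (rot (v, l))) s)) (h (v, j)))"
    by (intro sum.cong refl sum.swap)
  finally have "real d2 * S2 = (\<Sum>v\<in>V1. \<Sum>s<d2. real d2 * (\<Sum>l\<in>V2. \<Sum>j\<in>V2.
      K (f (fst (rot (v, l)), nb (snd (rot (v, l))) s)) (h (v, j))))"
    by (simp only: sum_distrib_left)
  also have "\<dots> \<le> (\<Sum>v\<in>V1. \<Sum>s<d2. g2 * ?n2 * (\<Sum>l\<in>V2. \<Sum>t<d2.
      K (f (fst (rot (v, l)), nb (snd (rot (v, l))) s)) (h (v, nb l t))))"
    using f h fin' nb by (intro sum_mono P2) (auto simp: Pi_iff)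
  also have "\<dots> = g2 * ?n2 * (\<Sum>v\<in>V1. \<Sum>s<d2. \<Sum>l\<in>V2. \<Sum>t<d2.
      K (f (fst (rot (v, l)), nb (snd (rot (v, l))) s)) (h (v, nb l t)))"
    by (simp only: sum_distrib_left)
  also have "(\<Sum>v\<in>V1. \<Sum>s<d2. \<Sum>l\<in>V2. \<Sum>t<d2.
      K (f (fst (rot (v, l)), nb (snd (rot (v, l))) s)) (h (v, nb l t))) = zigzag_sum K f h"
    unfolding zigzag_sum_def sum.cartesian_product' fst_conv snd_conv
    by (intro sum.cong refl sum.swap)
  finally have 3: "real d2 * S2 \<le> g2 * ?n2 * zigzag_sum K f h" .
  have "?n2 * ((real d2)\<^sup>2 * S0) = real d2 * (real d2 * (?n2 * S0))"
    by (simp add: power2_eq_square)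
  also have "\<dots> \<le> real d2 * (real d2 * (g1 * ?n1 * S1))"
    using 1 by (intro mult_left_mono) auto
  also have "\<dots> = g1 * ?n1 * (real d2 * (real d2 * S1))"
    by simp
  also have "\<dots> \<le> g1 * ?n1 * (real d2 * (g2 * ?n2 * S2))"
    using 2 g by (intro mult_left_mono) auto
  also have "\<dots> = g1 * ?n1 * (g2 * ?n2 * (real d2 * S2))"
    by simp
  also have "\<dots> \<le> g1 * ?n1 * (g2 * ?n2 * (g2 * ?n2 * zigzag_sum K f h))"
    using 3 g by (intro mult_left_mono) auto
  also have "\<dots> = ?n2 * (g1 * g2\<^sup>2 * card (V1 \<times> V2) * zigzag_sum K f h)"
    by (simp add: card_cartesian_product power2_eq_square)
  finally show ?thesis
    using assms(1) fin unfolding S0_def by (simp add: card_gt_0_iff)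
qed

text \<open>A \<open>G2\<close> step is the first step of \<open>d2\<close> paths and the last step
  of \<open>d2\<close> paths, while a middle edge lies on \<open>d2\<^sup>2\<close> paths. Hence
  \<open>2 * d2 \<le> d2\<^sup>2\<close> is what the case \<open>2 \<le> d2\<close>
  requires.\<close>

lemma zigzag_sum_le_edge_sums:
  fixes K :: "'a \<Rightarrow> 'a \<Rightarrow> real"
  assumes C: "1 \<le> C" and K: "\<And>a b. 0 \<le> K a b"
    and tri: "\<And>a b c d. a \<in> X \<Longrightarrow> b \<in> X \<Longrightarrow> c \<in> X \<Longrightarrow> d \<in> X \<Longrightarrow>
      K a d \<le> C * (K a b + K c b + K c d)"
    and f: "f \<in> V1 \<times> V2 \<rightarrow> X" and h: "h \<in> V1 \<times> V2 \<rightarrow> X"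
    and d2: "2 \<le> d2 \<or> d2 = 1 \<and> card V2 = 1"
  shows "zigzag_sum K f h \<le> C * (real d2)\<^sup>2 *
    ((\<Sum>w\<in>V1 \<times> V2. \<Sum>s<d2. K (f w) (h (fst w, nb (snd w) s)))
      + (\<Sum>w\<in>V1 \<times> V2. K (f w) (h (rot w))))"
    (is "_ \<le> _ * (?T + ?S)")
proof -
  have T0: "0 \<le> ?T" using K by (simp add: sum_nonneg)
  have "0 \<le> ?S" using K by (simp add: sum_nonneg)
  show ?thesis
    using d2
  proof
    assume "2 \<le> d2"
    have in_V: "fst (rot w) \<in> V1" "snd (rot w) \<in> V2" if "w \<in> V1 \<times> V2" for w
      using rot(1)[OF that] by (auto simp: mem_Times_iff)
    \<comment> \<open>The path alternates between the two maps: its inner vertices are read as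
      \<open>h (rot w)\<close> and \<open>f w\<close>. Each of the three terms thus compares a value
      of \<open>f\<close> with a value of \<open>h\<close>, which explains \<open>K c b\<close> in
      \<open>tri\<close>.\<close>
    let ?A = "\<lambda>w s. K (f (fst w, nb (snd w) s)) (h w)"
    have "zigzag_sum K f h \<le> (\<Sum>w\<in>V1 \<times> V2. \<Sum>s<d2. \<Sum>t<d2.
        C * (?A (rot w) s + K (f w) (h (rot w)) + K (f w) (h (fst w, nb (snd w) t))))"
      unfolding zigzag_sum_def
    proof (intro sum_mono tri)
      fix w s t assume "w \<in> V1 \<times> V2" "s \<in> {..<d2}" "t \<in> {..<d2}"
      then show "f (fst (rot w), nb (snd (rot w)) s) \<in> X" "h (fst w, nb (snd w) t) \<in> X"
        "h (rot w) \<in> X" "f w \<in> X"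
        using f h rot(1)[of w] in_V[of w] nb by (auto simp: Pi_iff)
    qed
    also have "\<dots> = C * (d2 * (\<Sum>w\<in>V1 \<times> V2. \<Sum>s<d2. ?A (rot w) s) + d2\<^sup>2 * ?S + d2 * ?T)"
      by (simp add: sum_distrib_left sum.distrib algebra_simps power2_eq_square)
    also have "(\<Sum>w\<in>V1 \<times> V2. \<Sum>s<d2. ?A (rot w) s) = (\<Sum>w\<in>V1 \<times> V2. \<Sum>s<d2. ?A w s)"
      by (rule sum_rot[of "\<lambda>w _. \<Sum>s<d2. ?A w s"])
    \<comment> \<open>In \<open>?A\<close> the argument of \<open>f\<close> moves along an edge of
      \<open>G2\<close>, in \<open>?T\<close> that of \<open>h\<close>; the symmetry of
      \<open>G2\<close> exchanges the two.\<close>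
    also have "\<dots> = ?T"
      unfolding sum.cartesian_product' fst_conv snd_conv
      by (intro sum.cong refl nb_sym[of "\<lambda>i j. K (f (u, i)) (h (u, j))" for u])
    also have "C * (d2 * ?T + d2\<^sup>2 * ?S + d2 * ?T) \<le> C * (d2\<^sup>2 * ?T + d2\<^sup>2 * ?S)"
    proof -
      have "real d2 * ?T + d2 * ?T = (2 * real d2) * ?T" by simp
      also have "\<dots> \<le> (real d2)\<^sup>2 * ?T"
        using \<open>2 \<le> d2\<close> T0 unfolding power2_eq_square by (intro mult_right_mono) auto
      finally show ?thesis using C by (intro mult_left_mono) auto
    qed
    finally show ?thesis by (simp add: algebra_simps)
  next
    assume "d2 = 1 \<and> card V2 = 1"
    then obtain c where c: "V2 = {c}" "d2 = 1" by (auto simp: card_1_singleton_iff)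
    have "zigzag_sum K f h = (\<Sum>w\<in>V1 \<times> V2. K (f (rot w)) (h w))"
      unfolding zigzag_sum_def
    proof (rule sum.cong[OF refl])
      fix w assume w: "w \<in> V1 \<times> V2"
      \<comment> \<open>The only neighbour of a single vertex is itself, so both \<open>G2\<close>
        steps are trivial and the path is just its middle edge.\<close>
      have "nb c 0 = c" using nb[of c 0] c by simp
      moreover have "(fst w, c) = w" "(fst (rot w), c) = rot w" "snd w = c" "snd (rot w) = c"
        using w rot(1)[OF w] c by (auto simp: mem_Times_iff prod_eq_iff)
      ultimately show "(\<Sum>s<d2. \<Sum>t<d2. K (f (fst (rot w), nb (snd (rot w)) s))
          (h (fst w, nb (snd w) t))) = K (f (rot w)) (h w)"
        using c by simp
    qed
    also have "\<dots> = ?S" by (rule sum_rot)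
    also have "\<dots> \<le> 1 * (?T + ?S)" using T0 by simp
    also have "\<dots> \<le> C * (?T + ?S)" using C T0 \<open>0 \<le> ?S\<close> by (intro mult_right_mono) auto
    finally show ?thesis using c by simp
  qed
qed

end

section \<open>The replacement product\<close>

text \<open>A 1-regular graph is a perfect matching in which a loop matches a vertex to itself. With
  more than one vertex, two-valued maps can agree across every edge without being constant, which no
  finite constant allows.\<close>

lemma card_verts_eq_1_of_poincare_ineq:
  fixes K :: "'a \<Rightarrow> 'a \<Rightarrow> real"
  assumes G: "regular 1 G" and "verts G \<noteq> {}"
    and P: "poincare_ineq (verts G) (normalized_adjacency G) X K g"
    and K: "\<And>a b. 0 \<le> K a b" "\<And>a b. a \<in> X \<Longrightarrow> b \<in> X \<Longrightarrow> K a b = 0 \<longleftrightarrow> a = b"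
    and ab: "a \<in> X" "b \<in> X" "a \<noteq> b"
  shows "card (verts G) = 1"
proof (rule ccontr)
  let ?V = "verts G"
  have fin: "finite ?V" and sym: "\<And>k l. k \<in> ?V \<Longrightarrow> l \<in> ?V \<Longrightarrow> num_edges G k l = num_edges G l k"
    and deg: "\<And>k. k \<in> ?V \<Longrightarrow> (\<Sum>l\<in>?V. num_edges G k l) = 1"
    using G by (auto simp: regular_def is_multigraph_def vertex_degree_def)
  assume "card ?V \<noteq> 1"
  then have "\<not> is_singleton ?V" by (simp add: is_singleton_altdef)
  then obtain i j where ij: "i \<in> ?V" "j \<in> ?V" "i \<noteq> j"
    using \<open>?V \<noteq> {}\<close> by (metis is_singletonI')
  have unique: "k = k'" if "l \<in> ?V" "k \<in> ?V" "k' \<in> ?V" "num_edges G l k \<noteq> 0" "num_edges G l k' \<noteq> 0"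
    for l k k'
  proof (rule ccontr)
    assume "k \<noteq> k'"
    then have "(\<Sum>m\<in>{k, k'}. num_edges G l m) \<le> (\<Sum>m\<in>?V. num_edges G l m)"
      using that fin by (intro sum_mono2) auto
    then show False using that deg \<open>k \<noteq> k'\<close> by simp
  qed
  \<comment> \<open>\<open>x\<close> singles out \<open>i\<close>, and \<open>y\<close> the partner
    of \<open>i\<close> (possibly \<open>i\<close> itself), so the two values coincide across each
    edge.\<close>
  define x where "x = (\<lambda>k. if k = i then a else b)"
  define y where "y = (\<lambda>l. if num_edges G i l \<noteq> 0 then a else b)"
  have xy: "x \<in> ?V \<rightarrow> X" "y \<in> ?V \<rightarrow> X"
    using ab by (auto simp: x_def y_def)
  have "num_edges G k l * K (x k) (y l) = 0" if kl: "k \<in> ?V" "l \<in> ?V" for k l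
  proof (cases "num_edges G k l = 0")
    case False
    then have "num_edges G l k \<noteq> 0" using sym kl by simp
    then have "k = i \<longleftrightarrow> num_edges G i l \<noteq> 0"
      using unique[of l k i] sym[of l i] kl ij False by auto
    then show ?thesis using K(2) ab by (auto simp: x_def y_def)
  qed simp
  then have "(\<Sum>k\<in>?V. \<Sum>l\<in>?V. num_edges G k l * K (x k) (y l)) = 0"
    by (intro sum.neutral ballI)
  moreover have "1 * (\<Sum>k\<in>?V. \<Sum>l\<in>?V. K (x k) (y l))
      \<le> g * real (card ?V) * (\<Sum>k\<in>?V. \<Sum>l\<in>?V. num_edges G k l * K (x k) (y l))"
    using bspec[OF bspec[OF iffD1[OF poincare_ineq_regular_iff[OF G _ \<open>?V \<noteq> {}\<close>] P] xy(1)] xy(2)]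
    by simp
  ultimately have "(\<Sum>k\<in>?V. \<Sum>l\<in>?V. K (x k) (y l)) \<le> 0" by simp
  moreover have "0 \<le> (\<Sum>k\<in>?V. \<Sum>l\<in>?V. K (x k) (y l))"
    using K(1) by (intro sum_nonneg)
  ultimately have "(\<Sum>k\<in>?V. \<Sum>l\<in>?V. K (x k) (y l)) = 0" by simp
  then have "K (x k) (y l) = 0" if "k \<in> ?V" "l \<in> ?V" for k l
    using fin K(1) that by (simp add: sum_nonneg_eq_0_iff sum_nonneg)
  then have "x k = y i" if "k \<in> ?V" for k
    using K(2)[of "x k" "y i"] xy that ij(1) by (auto simp: Pi_iff)
  then have "x i = x j" using ij by metis
  then show False using ij ab by (simp add: x_def)
qed

text \<open>The factor \<open>d2\<^sup>2\<close> in the zigzag inequality cancels against the one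
  from counting paths; \<open>d2 + 1\<close> enters only as the degree by which the adjacency matrix
  of the product is normalized.\<close>

lemma poincare_ineq_replacement_product:
  fixes K :: "'a \<Rightarrow> 'a \<Rightarrow> real" and G1 :: "'v multigraph" and G2 :: "'w multigraph"
  assumes G1: "regular d1 G1" and G2: "regular d2 G2" and d1: "card (verts G2) = d1"
    and bar: "edge_pairing G1 bar" and lab: "edge_labeling G1 G2 \<pi>"
    and ne: "verts G1 \<noteq> {}" "verts G2 \<noteq> {}"
    and d2: "2 \<le> d2 \<or> d2 = 1 \<and> d1 = 1"
    and C: "1 \<le> C" and K: "\<And>a b. 0 \<le> K a b"
    and tri: "\<And>a b c d. a \<in> X \<Longrightarrow> b \<in> X \<Longrightarrow> c \<in> X \<Longrightarrow> d \<in> X \<Longrightarrow>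
      K a d \<le> C * (K a b + K c b + K c d)"
    and g: "0 \<le> g1" "0 \<le> g2"
    and P1: "poincare_ineq (verts G1) (normalized_adjacency G1) X K g1"
    and P2: "poincare_ineq (verts G2) (normalized_adjacency G2) X K g2"
  shows "poincare_ineq (verts G1 \<times> verts G2)
    (normalized_adjacency (replacement_product G1 G2 bar \<pi>)) X K (C * real (d2 + 1) * g1 * g2\<^sup>2)"
proof -
  let ?V1 = "verts G1" and ?V2 = "verts G2" and ?R = "replacement_product G1 G2 bar \<pi>"
  have fin: "finite ?V1" "finite ?V2"
    and sym2: "\<And>i j. i \<in> ?V2 \<Longrightarrow> j \<in> ?V2 \<Longrightarrow> num_edges G2 i j = num_edges G2 j i"
    using G1 G2 by (auto simp: regular_def is_multigraph_def)
  have pos: "0 < d1" "0 < d2" using d1 d2 fin ne by (auto simp: card_gt_0_iff)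
  let ?rot = "rotation_map G1 bar \<pi>"
  obtain nb where nb: "\<And>i s. i \<in> ?V2 \<Longrightarrow> s < d2 \<Longrightarrow> nb i s \<in> ?V2"
    and sum_nb: "\<And>i (H::_ \<Rightarrow> real). i \<in> ?V2 \<Longrightarrow>
      (\<Sum>j\<in>?V2. num_edges G2 i j * H j) = (\<Sum>s<d2. H (nb i s))"
    using neighbour_enumeration[OF G2] by metis
  have rot: "\<And>w. w \<in> ?V1 \<times> ?V2 \<Longrightarrow> ?rot w \<in> ?V1 \<times> ?V2"
    "\<And>w. w \<in> ?V1 \<times> ?V2 \<Longrightarrow> ?rot (?rot w) = w"
    using rotation_map_involution[OF fin bar lab] by blast+
  have nb_sym: "(\<Sum>i\<in>?V2. \<Sum>s<d2. H (nb i s) i) = (\<Sum>i\<in>?V2. \<Sum>s<d2. H i (nb i s))"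
    for H :: "'w \<Rightarrow> 'w \<Rightarrow> real"
  proof -
    have "(\<Sum>i\<in>?V2. \<Sum>s<d2. H (nb i s) i) = (\<Sum>i\<in>?V2. \<Sum>j\<in>?V2. num_edges G2 i j * H j i)"
      by (simp add: sum_nb[of _ "\<lambda>j. H j i" for i])
    also have "\<dots> = (\<Sum>j\<in>?V2. \<Sum>i\<in>?V2. num_edges G2 j i * H j i)"
      by (subst sum.swap) (auto simp: sym2 intro!: sum.cong)
    also have "\<dots> = (\<Sum>i\<in>?V2. \<Sum>s<d2. H i (nb i s))"
      by (simp add: sum_nb)
    finally show ?thesis .
  qed
  note zz = fin rot nb nb_sym
  have R: "regular (d2 + 1) ?R"
    by (rule replacement_product_regular[OF G1 G2 bar lab])
  have VR: "verts ?R = ?V1 \<times> ?V2"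
    by (simp add: replacement_product_def)
  have P1': "real (card ?V2) * (\<Sum>u\<in>?V1. \<Sum>v\<in>?V1. K (x u) (y v))
      \<le> g1 * card ?V1 * (\<Sum>u\<in>?V1. \<Sum>k\<in>?V2. K (x u) (y (fst (?rot (u, k)))))"
    if "x \<in> ?V1 \<rightarrow> X" "y \<in> ?V1 \<rightarrow> X" for x y
  proof -
    have "(\<Sum>u\<in>?V1. \<Sum>k\<in>?V2. K (x u) (y (fst (?rot (u, k)))))
        = (\<Sum>u\<in>?V1. \<Sum>v\<in>?V1. num_edges G1 u v * K (x u) (y v))"
      using sum_num_edges_rotation[OF fin bar lab, of _ "\<lambda>v. K (x u) (y v)" for u]
      by (intro sum.cong) auto
    then show ?thesis
      using P1 that d1 unfolding poincare_ineq_regular_iff[OF G1 pos(1) ne(1)] by simp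
  qed
  have P2': "real d2 * (\<Sum>i\<in>?V2. \<Sum>j\<in>?V2. K (x i) (y j))
      \<le> g2 * card ?V2 * (\<Sum>i\<in>?V2. \<Sum>s<d2. K (x i) (y (nb i s)))"
    if "x \<in> ?V2 \<rightarrow> X" "y \<in> ?V2 \<rightarrow> X" for x y
  proof -
    have "(\<Sum>i\<in>?V2. \<Sum>s<d2. K (x i) (y (nb i s)))
        = (\<Sum>i\<in>?V2. \<Sum>j\<in>?V2. num_edges G2 i j * K (x i) (y j))"
      by (intro sum.cong refl sum_nb[symmetric])
    then show ?thesis
      using P2 that unfolding poincare_ineq_regular_iff[OF G2 pos(2) ne(2)] by simp
  qed
  have "real (d2 + 1) * (\<Sum>w\<in>?V1 \<times> ?V2. \<Sum>w'\<in>?V1 \<times> ?V2. K (f w) (h w'))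
      \<le> C * real (d2 + 1) * g1 * g2\<^sup>2 * card (?V1 \<times> ?V2)
        * (\<Sum>w\<in>?V1 \<times> ?V2. \<Sum>w'\<in>?V1 \<times> ?V2. num_edges ?R w w' * K (f w) (h w'))"
    (is "_ * ?S0 \<le> _ * ?E")
    if f: "f \<in> ?V1 \<times> ?V2 \<rightarrow> X" and h: "h \<in> ?V1 \<times> ?V2 \<rightarrow> X" for f h
  proof -
    have E: "?E = (\<Sum>w\<in>?V1 \<times> ?V2. \<Sum>s<d2. K (f w) (h (fst w, nb (snd w) s)))
        + (\<Sum>w\<in>?V1 \<times> ?V2. K (f w) (h (?rot w)))"
      unfolding sum.distrib[symmetric]
    proof (rule sum.cong[OF refl])
      fix w assume "w \<in> ?V1 \<times> ?V2"
      then obtain u i where w: "w = (u, i)" "u \<in> ?V1" "i \<in> ?V2" by auto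
      show "(\<Sum>w'\<in>?V1 \<times> ?V2. num_edges ?R w w' * K (f w) (h w'))
          = (\<Sum>s<d2. K (f w) (h (fst w, nb (snd w) s))) + K (f w) (h (?rot w))"
        using sum_num_edges_replacement_product[OF fin bar lab w(2,3), of "\<lambda>w'. K (f w) (h w')"]
          sum_nb[OF w(3), of "\<lambda>j. K (f w) (h (u, j))"] w(1) by simp
    qed
    let ?n = "real (card (?V1 \<times> ?V2))"
    have "(real d2)\<^sup>2 * ?S0 \<le> g1 * g2\<^sup>2 * ?n * zigzag_sum ?V1 ?V2 d2 ?rot nb K f h"
      by (rule zigzag_poincare[OF zz ne(2) g P1' P2' f h])
    also have "\<dots> \<le> g1 * g2\<^sup>2 * ?n * (C * (real d2)\<^sup>2 * ?E)"
      unfolding E using g d2 d1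
      by (intro mult_left_mono zigzag_sum_le_edge_sums[OF zz C K tri f h]) auto
    also have "\<dots> = (real d2)\<^sup>2 * (C * g1 * g2\<^sup>2 * ?n * ?E)"
      by simp
    finally have "?S0 \<le> C * g1 * g2\<^sup>2 * ?n * ?E"
      using pos by simp
    then have "real (d2 + 1) * ?S0 \<le> real (d2 + 1) * (C * g1 * g2\<^sup>2 * ?n * ?E)"
      by (intro mult_left_mono) auto
    then show ?thesis by (simp only: mult_ac)
  qed
  then show ?thesis
    using poincare_ineq_regular_iff[OF R, of X K] ne unfolding VR by simp
qed

theorem corollary8p5:
  fixes p :: real
    and X :: "'a set" and dX :: "'a \<Rightarrow> 'a \<Rightarrow> real"
    and n1 d1 d2 :: nat
    and G1 :: "'v multigraph" and G2 :: "'w multigraph"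
    and bar :: "'v edge_copy \<Rightarrow> 'v edge_copy"
    and \<pi> :: "'v \<Rightarrow> 'v edge_copy \<Rightarrow> 'w"
  assumes "1 \<le> p"
    and "Metric_space X dX"
    and "regular d1 G1" and "card (verts G1) = n1"
    and "regular d2 G2" and "card (verts G2) = d1"
    and "edge_pairing G1 bar"
    and "edge_labeling G1 G2 \<pi>"
  shows "gamma_plus_graph (replacement_product G1 G2 bar \<pi>) X (\<lambda>x y. dX x y powr p)
    \<le> ennreal (3 powr (p - 1)) * of_nat (d2 + 1)
        * gamma_plus_graph G1 X (\<lambda>x y. dX x y powr p)
        * (gamma_plus_graph G2 X (\<lambda>x y. dX x y powr p))\<^sup>2"
proof -
  interpret Metric_space X dX by fact
  let ?V1 = "verts G1" and ?V2 = "verts G2" and ?R = "replacement_product G1 G2 bar \<pi>"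
  define K where "K = (\<lambda>x y. dX x y powr p)"
  define C where "C = (3::real) powr (p - 1)"
  let ?g1 = "gamma_plus ?V1 (normalized_adjacency G1) X K"
  let ?g2 = "gamma_plus ?V2 (normalized_adjacency G2) X K"
  let ?gR = "gamma_plus (?V1 \<times> ?V2) (normalized_adjacency ?R) X K"
  have VR: "verts ?R = ?V1 \<times> ?V2"
    by (simp add: replacement_product_def)
  have fin: "finite ?V1" "finite ?V2"
    using assms by (auto simp: regular_def is_multigraph_def)
  have C: "1 \<le> C"
    using assms(1) by (simp add: C_def ge_one_powr_ge_zero)
  have K: "\<And>a b. 0 \<le> K a b" by (simp add: K_def)
  have K0: "K a b = 0 \<longleftrightarrow> a = b" if "a \<in> X" "b \<in> X" for a b
    using that by (simp add: K_def)
  have tri: "K a d \<le> C * (K a b + K c b + K c d)"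
    if "a \<in> X" "b \<in> X" "c \<in> X" "d \<in> X" for a b c d
  proof -
    have "dX a d \<le> dX a b + dX c b + dX c d"
      using triangle[of a b d] triangle[of b c d] commute[of b c] that by simp
    then have "K a d \<le> (dX a b + dX c b + dX c d) powr p"
      unfolding K_def using assms(1) by (intro powr_mono2) auto
    also have "\<dots> \<le> C * (K a b + K c b + K c d)"
      unfolding K_def C_def using assms(1) by (intro powr_add3_le) auto
    finally show ?thesis .
  qed
  have "?gR \<le> ennreal C * of_nat (d2 + 1) * ?g1 * ?g2\<^sup>2"
  proof (cases "?V1 \<times> ?V2 = {} \<or> (\<forall>a\<in>X. \<forall>b\<in>X. K a b = 0)")
    case True
    then show ?thesis by (simp add: gamma_plus_eq_0)
  next
    case False
    then obtain a b where ab: "a \<in> X" "b \<in> X" "K a b \<noteq> 0" and ne: "?V1 \<noteq> {}" "?V2 \<noteq> {}"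
      by auto
    \<comment> \<open>Needed when a constant is infinite, because \<open>0 * top = 0\<close> in \<open>ennreal\<close>.\<close>
    have nz: "?g1 \<noteq> 0" "?g2 \<noteq> 0"
      by (rule gamma_plus_nonzero[where a = a and b = b];
        use ab fin ne K in \<open>simp add: normalized_adjacency_nonneg\<close>)+
    have C': "ennreal C * of_nat (d2 + 1) \<noteq> 0"
      using C by (simp add: ennreal_eq_0_iff)
    show ?thesis
    proof (cases "?g1 = top \<or> ?g2 = top")
      case True
      then have "ennreal C * of_nat (d2 + 1) * ?g1 * ?g2\<^sup>2 = top"
        using nz C' by (auto simp: ennreal_mult_eq_top_iff ennreal_top_mult ennreal_mult_top power2_eq_square)
      then show ?thesis by (simp only: top_greatest)
    next
      case False
      obtain r1 where r1: "0 \<le> r1" "?g1 = ennreal r1"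
        "\<And>e. 0 < e \<Longrightarrow> poincare_ineq ?V1 (normalized_adjacency G1) X K (r1 + e)"
        using gamma_plus_finiteE[of ?V1 "normalized_adjacency G1" X K] False K
          normalized_adjacency_nonneg by metis
      obtain r2 where r2: "0 \<le> r2" "?g2 = ennreal r2"
        "\<And>e. 0 < e \<Longrightarrow> poincare_ineq ?V2 (normalized_adjacency G2) X K (r2 + e)"
        using gamma_plus_finiteE[of ?V2 "normalized_adjacency G2" X K] False K
          normalized_adjacency_nonneg by metis
      \<comment> \<open>The slack 1 is arbitrary: the existence of some finite constant is enough to
        restrict small degrees.\<close>
      have P2: "poincare_ineq ?V2 (normalized_adjacency G2) X K (r2 + 1)"
        using r2 by simp
      \<comment> \<open>Without edges the matrix is zero, and constant maps at positive distance
        already contradict \<open>P2\<close>.\<close>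
      have "d2 \<noteq> 0"
      proof
        assume "d2 = 0"
        then have "normalized_adjacency G2 i j = 0" if "i \<in> ?V2" for i j
          using assms(5) that by (simp add: normalized_adjacency_def regular_def)
        then have "K a b \<le> 0"
          using poincare_ineq_const[OF P2 fin(2) ne(2) ab(1,2)] by simp
        then show False using K[of a b] ab by simp
      qed
      moreover have "d1 = 1" if "d2 = 1"
        using card_verts_eq_1_of_poincare_ineq[OF _ ne(2) P2 K K0 ab(1,2)] assms(5,6) ab K0 that
        by auto
      ultimately have d2: "2 \<le> d2 \<or> d2 = 1 \<and> d1 = 1"
        by linarith
      let ?c = "\<lambda>e. C * real (d2 + 1) * (r1 + e) * (r2 + e)\<^sup>2"
      have le: "?gR \<le> ennreal (?c e)" if "0 < e" for e
      proof (rule gamma_plus_le)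
        show "0 < ?c e" using that C r1 r2 by (intro mult_pos_pos zero_less_power) auto
        show "poincare_ineq (?V1 \<times> ?V2) (normalized_adjacency ?R) X K (?c e)"
          by (rule poincare_ineq_replacement_product[OF assms(3,5,6,7,8) ne d2 C K tri])
            (use r1 r2 that in auto)
      qed
      \<comment> \<open>The bound holds for every positive slack and is continuous in it, so it
        persists at \<open>e = 0\<close>, where \<open>?c\<close> contains the constants
        themselves.\<close>
      have "((\<lambda>e. ennreal (?c e)) \<longlongrightarrow> ennreal (?c 0)) (at_right 0)"
        by (intro tendsto_ennrealI) (auto intro!: tendsto_eq_intros)
      moreover have "\<forall>\<^sub>F e in at_right 0. ?gR \<le> ennreal (?c e)"
        using le by (auto simp: eventually_at_right_field intro: exI[of _ 1])
      ultimately have "?gR \<le> ennreal (?c 0)"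
        by (intro tendsto_lowerbound[where F = "at_right (0::real)"]) auto
      also have "\<dots> = ennreal C * of_nat (d2 + 1) * ?g1 * ?g2\<^sup>2"
        using r1 r2 C by (simp add: ennreal_mult ennreal_power ennreal_of_nat_eq_real_of_nat
            del: of_nat_add of_nat_Suc)
      finally show ?thesis .
    qed
  qed
  then show ?thesis
    unfolding gamma_plus_graph_def VR K_def C_def .
qed

end
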